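(* There are infinitely many isomorphism classes of complex $4$-dimensional one-generated nilpotent terminal algebras, and they are described explicitly by the following list, consisting of $1$ two-parametric family, $4$ one-parameter families and $5$ additional algebras: each algebra in the list is a complex $4$-dimensional one-generated nilpotent terminal algebra, and every complex $4$-dimensional one-generated nilpotent terminal algebra is isomorphic to one of the algebras in the list. Here $e_1,e_2,e_3,e_4$ is a basis, the parameters $\lambda,\alpha$ range over $\mathbb{C}$, and all products of basis vectors that are not listed are zero. $T^4_{01}$: $e_1e_1=e_2,\ e_1e_2=e_4,\ e_2e_1=e_3$. $T^4_{02}(\alpha)$: $e_1e_1=e_2,\ e_1e_2=e_3,\ e_1e_3=\alpha e_4,\ e_2e_2=e_4,\ e_3e_1=-3e_4$. $T^4_{03}$: $e_1e_1=e_2,\ e_1e_2=e_3,\ e_1e_3=e_4$. $T^4_{04}$: $e_1e_1=e_2,\ e_1e_2=e_3,\ e_1e_3=e_4,\ e_2e_1=e_4$. $T^4_{05}(\lambda,\alpha)$: $e_1e_1=e_2,\ e_1e_2=\lambda e_3,\ e_1e_3=\alpha e_4,\ e_2e_1=e_3,\ e_2e_2=\left(\alpha+\frac{1-\lambda}{3}\right)e_4,\ e_3e_1=e_4$. $T^4_{06}(\lambda)$: $e_1e_1=e_2,\ e_1e_2=\lambda e_3+e_4,\ e_1e_3=\frac{2\lambda^2+5\lambda-1}{6}e_4,\ e_2e_1=e_3,\ e_2e_2=\frac{(2\lambda+1)(\lambda+1)}{6}e_4,\ e_3e_1=e_4$. $T^4_{07}(\lambda)$: $e_1e_1=e_2,\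 e_1e_2=\lambda e_3,\ e_1e_3=e_4,\ e_2e_1=e_3,\ e_2e_2=e_4$. $T^4_{08}$: $e_1e_1=e_2,\ e_2e_1=e_3,\ e_2e_3=e_4$. $T^4_{09}$: $e_1e_1=e_2,\ e_1e_2=e_4,\ e_2e_1=e_3,\ e_2e_3=e_4$. $T^4_{10}(\alpha)$: $e_1e_1=e_2,\ e_1e_2=\alpha e_4,\ e_2e_1=e_3,\ e_2e_2=\frac13 e_4,\ e_2e_3=e_4,\ e_3e_1=e_4$.
   Context: An algebra over $\mathbb{C}$ is a complex vector space $V$ with a bilinear multiplication $P:V\times V\to V$, written $P(x,y)=xy$; no associativity, commutativity or unit is assumed. For $x,y,z\in V$, a linear operator $A:V\to V$ and bilinear operators $B,C:V\times V\to V$, set $[B,x](y)=B(x,y)$ (so $[B,x]$ is a linear operator); $[A,B](x,y)=A(B(x,y))-B(A(x),y)-B(x,A(y))$ (a bilinear operator); $[B,C](x,y,z)=B(C(x,y),z)+B(x,C(y,z))+B(y,C(x,z))-C(B(x,y),z)-C(x,B(y,z))-C(y,B(x,z))$ (a trilinear operator). The algebra $(V,P)$ is terminal if $[[[P,a],P],P]=0$ for all $a\in V$. An algebra is one-generated if it is generated, as an algebra, by a single element. An algebra $A$ is nilpotent if $A^n=0$ for some $n$, where $A^1=A$ and $A^n=\sum_{i=1}^{n-1}A^iA^{n-i}$. *)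

theory Defs
  imports "HOL-Analysis.Analysis"
begin

text \<open>Brackets \<open>[B, x]\<close>, \<open>[A, B]\<close> and \<open>[B, C]\<close> of a linear operator \<open>A\<close>, bilinear
  operators \<open>B, C\<close> and a vector \<open>x\<close>.\<close>

definition bracket_bil_vec :: "('v \<Rightarrow> 'v \<Rightarrow> 'v) \<Rightarrow> 'v \<Rightarrow> 'v \<Rightarrow> 'v" where
  "bracket_bil_vec B x = (\<lambda>y. B x y)"

definition bracket_lin_bil :: "('v::ab_group_add \<Rightarrow> 'v) \<Rightarrow> ('v \<Rightarrow> 'v \<Rightarrow> 'v) \<Rightarrow> 'v \<Rightarrow> 'v \<Rightarrow> 'v" where
  "bracket_lin_bil A B = (\<lambda>x y. A (B x y) - B (A x) y - B x (A y))"

definition bracket_bil_bil ::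
  "('v::ab_group_add \<Rightarrow> 'v \<Rightarrow> 'v) \<Rightarrow> ('v \<Rightarrow> 'v \<Rightarrow> 'v) \<Rightarrow> 'v \<Rightarrow> 'v \<Rightarrow> 'v \<Rightarrow> 'v" where
  "bracket_bil_bil B C = (\<lambda>x y z.
     B (C x y) z + B x (C y z) + B y (C x z) - C (B x y) z - C x (B y z) - C y (B x z))"

locale complex_algebra = vector_space scale
  for scale :: "complex \<Rightarrow> 'v::ab_group_add \<Rightarrow> 'v" +
  fixes mult :: "'v \<Rightarrow> 'v \<Rightarrow> 'v"
  assumes linear_mult_left: "Vector_Spaces.linear scale scale (\<lambda>x. mult x y)"
    and linear_mult_right: "Vector_Spaces.linear scale scale (\<lambda>y. mult x y)"
begin

definition terminal :: bool where
  "terminal \<longleftrightarrow>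
    (\<forall>a. bracket_bil_bil (bracket_lin_bil (bracket_bil_vec mult a) mult) mult = (\<lambda>x y z. 0))"

definition subalgebra :: "'v set \<Rightarrow> bool" where
  "subalgebra S \<longleftrightarrow> subspace S \<and> (\<forall>x\<in>S. \<forall>y\<in>S. mult x y \<in> S)"

definition one_generated :: bool where
  "one_generated \<longleftrightarrow> (\<exists>g. subalgebra hull {g} = UNIV)"

text \<open>The sum of the subspaces \<open>A\<^sup>i A\<^sup>n\<^sup>-\<^sup>i\<close>, each of which is the span of the products,
  is the span of all these products. The value at \<open>n = 0\<close> is a dummy.\<close>

fun alg_power :: "nat \<Rightarrow> 'v set" where
  "alg_power n = (if n \<le> 1 then UNIV
     else span (\<Union>i\<in>{1..n-1}. {mult x y | x y. x \<in> alg_power i \<and> y \<in> alg_power (n - i)}))"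

declare alg_power.simps [simp del]

definition nilpotent :: bool where
  "nilpotent \<longleftrightarrow> (\<exists>n\<ge>1. alg_power n = {0})"

end

definition one_gen_nilp_term_alg4 ::
  "(complex \<Rightarrow> 'v::ab_group_add \<Rightarrow> 'v) \<Rightarrow> ('v \<Rightarrow> 'v \<Rightarrow> 'v) \<Rightarrow> bool" where
  "one_gen_nilp_term_alg4 sc P \<longleftrightarrow>
     complex_algebra sc P \<and> vector_space.dim sc (UNIV :: 'v set) = 4 \<and>
     complex_algebra.one_generated sc P \<and> complex_algebra.nilpotent sc P \<and>
     complex_algebra.terminal P"

definition algebra_isomorphic ::
  "(complex \<Rightarrow> 'v::ab_group_add \<Rightarrow> 'v) \<Rightarrow> ('v \<Rightarrow> 'v \<Rightarrow> 'v) \<Rightarrow>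
   (complex \<Rightarrow> 'w::ab_group_add \<Rightarrow> 'w) \<Rightarrow> ('w \<Rightarrow> 'w \<Rightarrow> 'w) \<Rightarrow> bool" where
  "algebra_isomorphic s P t Q \<longleftrightarrow>
     (\<exists>f. Vector_Spaces.linear s t f \<and> bij f \<and> (\<forall>x y. f (P x y) = Q (f x) (f y)))"

text \<open>The isomorphism relation on the algebras in question with underlying space \<open>\<complex>\<^sup>4\<close>; every
  4-dimensional algebra is isomorphic to one on this space, so the equivalence classes
  represent all isomorphism classes.\<close>

definition algs4 :: "(complex^4 \<Rightarrow> complex^4 \<Rightarrow> complex^4) set" where
  "algs4 = {P. one_gen_nilp_term_alg4 (*s) P}"

definition iso_rel4 ::
  "((complex^4 \<Rightarrow> complex^4 \<Rightarrow> complex^4) \<times> (complex^4 \<Rightarrow> complex^4 \<Rightarrow> complex^4)) set" where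
  "iso_rel4 = {(P, Q). P \<in> algs4 \<and> Q \<in> algs4 \<and> algebra_isomorphic (*s) P (*s) Q}"

text \<open>The standard basis \<open>e\<^sub>1, \<dots>, e\<^sub>4\<close>. In the four-element index type the numeral \<open>4\<close>
  equals \<open>0\<close>, and \<open>1, 2, 3, 4\<close> are its four distinct elements.\<close>

definition e :: "4 \<Rightarrow> complex^4" where
  "e i = axis i 1"

text \<open>The bilinear multiplication given by a table with entries \<open>(i, j, v)\<close>, meaning
  \<open>e\<^sub>i e\<^sub>j = v\<close>; products of basis vectors that are not listed are zero (the pairs
  \<open>(i, j)\<close> in a table are assumed to be distinct).\<close>

definition table_mult :: "(4 \<times> 4 \<times> (complex^4)) list \<Rightarrow> complex^4 \<Rightarrow> complex^4 \<Rightarrow> complex^4" where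
  "table_mult tab x y = (\<Sum>(i, j, v)\<leftarrow>tab. (x $ i * y $ j) *s v)"

text \<open>The parameter \<open>\<lambda>\<close> of the families is called \<open>\<mu>\<close> here.\<close>

definition T01 where
  "T01 = table_mult [(1, 1, e 2), (1, 2, e 4), (2, 1, e 3)]"

definition T02 where
  "T02 \<alpha> = table_mult
     [(1, 1, e 2), (1, 2, e 3), (1, 3, \<alpha> *s e 4), (2, 2, e 4), (3, 1, (-3) *s e 4)]"

definition T03 where
  "T03 = table_mult [(1, 1, e 2), (1, 2, e 3), (1, 3, e 4)]"

definition T04 where
  "T04 = table_mult [(1, 1, e 2), (1, 2, e 3), (1, 3, e 4), (2, 1, e 4)]"

definition T05 where
  "T05 \<mu> \<alpha> = table_mult
     [(1, 1, e 2), (1, 2, \<mu> *s e 3), (1, 3, \<alpha> *s e 4), (2, 1, e 3),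
      (2, 2, (\<alpha> + (1 - \<mu>) / 3) *s e 4), (3, 1, e 4)]"

definition T06 where
  "T06 \<mu> = table_mult
     [(1, 1, e 2), (1, 2, \<mu> *s e 3 + e 4), (1, 3, ((2 * \<mu>^2 + 5 * \<mu> - 1) / 6) *s e 4),
      (2, 1, e 3), (2, 2, ((2 * \<mu> + 1) * (\<mu> + 1) / 6) *s e 4), (3, 1, e 4)]"

definition T07 where
  "T07 \<mu> = table_mult
     [(1, 1, e 2), (1, 2, \<mu> *s e 3), (1, 3, e 4), (2, 1, e 3), (2, 2, e 4)]"

definition T08 where
  "T08 = table_mult [(1, 1, e 2), (2, 1, e 3), (2, 3, e 4)]"

definition T09 where
  "T09 = table_mult [(1, 1, e 2), (1, 2, e 4), (2, 1, e 3), (2, 3, e 4)]"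

definition T10 where
  "T10 \<alpha> = table_mult
     [(1, 1, e 2), (1, 2, \<alpha> *s e 4), (2, 1, e 3), (2, 2, (1 / 3) *s e 4), (2, 3, e 4), (3, 1, e 4)]"

definition T_list :: "(complex^4 \<Rightarrow> complex^4 \<Rightarrow> complex^4) set" where
  "T_list = {T01} \<union> {T02 \<alpha> | \<alpha>. True} \<union> {T03} \<union> {T04} \<union> {T05 \<mu> \<alpha> | \<mu> \<alpha>. True} \<union>
     {T06 \<mu> | \<mu>. True} \<union> {T07 \<mu> | \<mu>. True} \<union> {T08} \<union> {T09} \<union> {T10 \<alpha> | \<alpha>. True}"

lemma table_mult_basis:
  "table_mult tab (e k) (e l) = (\<Sum>(i, j, v)\<leftarrow>tab. if (i, j) = (k, l) then v else 0)"
  unfolding table_mult_def e_def axis_def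
  by (intro arg_cong[of _ _ sum_list] map_cong) (auto simp: vec_eq_iff)

end

theory Submission
  imports Defs
begin

text \<open>In a nilpotent algebra every proper subspace \<open>S\<close> admits some \<open>u \<notin> S\<close> annihilated by the algebra
  modulo \<open>S\<close>. Starting from \<open>S = 0\<close> this builds a flag of ideals, hence a basis \<open>e\<^sub>1, e\<^sub>1e\<^sub>1, e\<^sub>3, e\<^sub>4\<close> with \<open>e\<^sub>1\<close> a
  generator, in which the product is strictly triangular and given by eleven structure constants.
  Evaluating the terminal identity on basis vectors kills three of them, determines \<open>e\<^sub>2e\<^sub>2\<close>, and
  forces \<open>e\<^sub>1e\<^sub>2 \<in> \<langle>e\<^sub>4\<rangle>\<close> or \<open>e\<^sub>2e\<^sub>3 = 0\<close>. A change of generator \<open>e\<^sub>1 \<mapsto> k e\<^sub>1 + x e\<^sub>2\<close> and rescaling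
  then reach the normal forms. Infinitely many classes are separated by the identity
  \<open>(x(xx) - \<mu> (xx)x)y = 0\<close>, which holds in \<open>T05 \<nu> \<alpha>\<close> only for \<open>\<mu> = \<nu>\<close>.\<close>

section \<open>Isomorphisms\<close>

lemma algebra_isomorphic_sym:
  assumes "algebra_isomorphic s P t Q"
  shows "algebra_isomorphic t Q s P"
proof -
  obtain f where f: "Vector_Spaces.linear s t f" "bij f" "\<And>x y. f (P x y) = Q (f x) (f y)"
    using assms unfolding algebra_isomorphic_def by blast
  interpret f: Vector_Spaces.linear s t f by fact
  have inj: "inj f" and surj: "\<And>y. f (inv f y) = y"
    using f(2) by (auto simp: bij_def surj_f_inv_f)
  have "Vector_Spaces.linear t s (inv f)"
    unfolding Vector_Spaces.linear_iff
    using f.vs1.vector_space_axioms f.vs2.vector_space_axioms surj inj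
    by (auto intro!: injD[OF inj] simp: f.add f.scale)
  moreover have "inv f (Q x y) = P (inv f x) (inv f y)" for x y
    by (rule injD[OF inj]) (simp add: surj f(3))
  ultimately show ?thesis
    unfolding algebra_isomorphic_def using bij_imp_bij_inv[OF f(2)] by blast
qed

lemma algebra_isomorphic_trans:
  assumes "algebra_isomorphic s P t Q" "algebra_isomorphic t Q u R"
  shows "algebra_isomorphic s P u R"
proof -
  obtain f where f: "Vector_Spaces.linear s t f" "bij f" "\<And>x y. f (P x y) = Q (f x) (f y)"
    using assms(1) unfolding algebra_isomorphic_def by blast
  obtain g where g: "Vector_Spaces.linear t u g" "bij g" "\<And>x y. g (Q x y) = R (g x) (g y)"
    using assms(2) unfolding algebra_isomorphic_def by blast
  show ?thesis
    unfolding algebra_isomorphic_def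
    using Vector_Spaces.linear_compose[OF f(1) g(1)] bij_comp[OF f(2) g(2)] f(3) g(3)
    by (intro exI[of _ "g \<circ> f"]) auto
qed

lemma algebra_isomorphic_refl:
  assumes "vector_space s"
  shows "algebra_isomorphic s P s P"
proof -
  interpret vector_space s by fact
  show ?thesis
    unfolding algebra_isomorphic_def using linear_id bij_id by (intro exI[of _ id]) auto
qed

text \<open>In finite dimension an injective endomorphism is bijective, so the explicit changes of
  basis below need only a kernel check.\<close>

lemma linear_inj_imp_isomorphic:
  fixes f :: "complex^'n \<Rightarrow> complex^'n"
  assumes "Vector_Spaces.linear (*s) (*s) f" "\<And>x. f x = 0 \<Longrightarrow> x = 0"
    "\<And>x y. f (P x y) = Q (f x) (f y)"
  shows "algebra_isomorphic (*s) P (*s) Q"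
proof -
  interpret f: Vector_Spaces.linear "(*s)" "(*s)" f by fact
  have "inj f"
  proof (rule injI)
    fix x y assume "f x = f y"
    then have "f (x - y) = 0" by (simp add: f.diff)
    with assms(2) show "x = y" by fastforce
  qed
  then have "bij f"
    using vec.linear_injective_imp_surjective[OF assms(1)] by (simp add: bij_def)
  with assms show ?thesis unfolding algebra_isomorphic_def by blast
qed

section \<open>Multiplications compatible with a flag\<close>

text \<open>The general product adapted to the flag, with \<open>e 2\<close> the square of
  \<open>e 1\<close>: any product involving \<open>e i\<close> lies in the span of the later basis
  vectors. A primed letter is the \<open>e 4\<close> part of the product whose \<open>e 3\<close>
  part is the unprimed letter.\<close>

definition flag_mult :: "complex \<Rightarrow> complex \<Rightarrow> complex \<Rightarrow> complex \<Rightarrow> complex \<Rightarrow> complex \<Rightarrow>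
    complex \<Rightarrow> complex \<Rightarrow> complex \<Rightarrow> complex \<Rightarrow> complex \<Rightarrow> complex^4 \<Rightarrow> complex^4 \<Rightarrow> complex^4" where
  "flag_mult a a' b b' c c' p q r s t x y =
     (x$1 * y$1) *s e 2 + (a * x$1 * y$2 + b * x$2 * y$1 + c * x$2 * y$2) *s e 3 +
     (a' * x$1 * y$2 + b' * x$2 * y$1 + c' * x$2 * y$2 + p * x$1 * y$3 + q * x$3 * y$1 +
      r * x$2 * y$3 + s * x$3 * y$2 + t * x$3 * y$3) *s e 4"

lemma e_nth [simp]:
  "e 1 $ 1 = 1" "e 1 $ 2 = 0" "e 1 $ 3 = 0" "e 1 $ 4 = 0"
  "e 2 $ 1 = 0" "e 2 $ 2 = 1" "e 2 $ 3 = 0" "e 2 $ 4 = 0"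
  "e 3 $ 1 = 0" "e 3 $ 2 = 0" "e 3 $ 3 = 1" "e 3 $ 4 = 0"
  "e 4 $ 1 = 0" "e 4 $ 2 = 0" "e 4 $ 3 = 0" "e 4 $ 4 = 1"
  by (simp_all add: e_def axis_def)

lemma vec4_eq_iff:
  "x = y \<longleftrightarrow> x$1 = y$1 \<and> x$2 = y$2 \<and> x$3 = y$3 \<and> x$4 = y$4" for x y :: "complex^4"
  by (simp add: vec_eq_iff forall_4)

lemma vec4_expand: "x = x$1 *s e 1 + x$2 *s e 2 + x$3 *s e 3 + x$4 *s e 4"
  by (simp add: vec4_eq_iff)

lemma flag_mult_nth [simp]:
  "flag_mult a a' b b' c c' p q r s t x y $ 1 = 0"
  "flag_mult a a' b b' c c' p q r s t x y $ 2 = x$1 * y$1"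
  "flag_mult a a' b b' c c' p q r s t x y $ 3 = a * x$1 * y$2 + b * x$2 * y$1 + c * x$2 * y$2"
  "flag_mult a a' b b' c c' p q r s t x y $ 4 =
     a' * x$1 * y$2 + b' * x$2 * y$1 + c' * x$2 * y$2 + p * x$1 * y$3 + q * x$3 * y$1 +
      r * x$2 * y$3 + s * x$3 * y$2 + t * x$3 * y$3"
  by (simp_all add: flag_mult_def)

lemma complex_algebra_flag_mult: "complex_algebra (*s) (flag_mult a a' b b' c c' p q r s t)"
  by unfold_locales (simp_all add: vec4_eq_iff algebra_simps)

text \<open>Terminality forces \<open>c = s = t = 0\<close>, see \<open>terminal_flag_mult_imp\<close>.\<close>

abbreviation flag_mult0 where
  "flag_mult0 a a' b b' c' p q r \<equiv> flag_mult a a' b b' 0 c' p q r 0 0"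

text \<open>Reduces the list to structure constants. The \<open>e 4\<close> coefficient of the
  square of \<open>e 2\<close> in \<open>T06\<close> is rewritten in the shape that terminality
  prescribes for \<open>b = q = 1\<close>.\<close>

lemma T_eq_flag_mult:
  "T01 = flag_mult0 0 1 1 0 0 0 0 0"
  "T02 \<alpha> = flag_mult0 1 0 0 0 1 \<alpha> (-3) 0"
  "T03 = flag_mult0 1 0 0 0 0 1 0 0"
  "T04 = flag_mult0 1 0 0 1 0 1 0 0"
  "T05 \<mu> \<alpha> = flag_mult0 \<mu> 0 1 0 (\<alpha> + (1 - \<mu>) / 3) \<alpha> 1 0"
  "T06 \<mu> = flag_mult0 \<mu> 1 1 0 ((2 * \<mu>^2 + 5 * \<mu> - 1) / 6 + (1 - \<mu>) / 3)
     ((2 * \<mu>^2 + 5 * \<mu> - 1) / 6) 1 0"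
  "T07 \<mu> = flag_mult0 \<mu> 0 1 0 1 1 0 0"
  "T08 = flag_mult0 0 0 1 0 0 0 0 1"
  "T09 = flag_mult0 0 1 1 0 0 0 0 1"
  "T10 \<alpha> = flag_mult0 0 \<alpha> 1 0 (1 / 3) 0 1 1"
  by (rule ext, rule ext, simp add: vec4_eq_iff table_mult_def T01_def T02_def T03_def T04_def
      T05_def T06_def T07_def T08_def T09_def T10_def;
      simp add: field_simps power2_eq_square)+

section \<open>Terminality\<close>

lemma terminal_flag_mult0:
  assumes "c' = b * p + (b - a) * q / 3" "a * r = 0"
  shows "complex_algebra.terminal (flag_mult0 a a' b b' c' p q r)"
proof -
  interpret complex_algebra "(*s)" "flag_mult0 a a' b b' c' p q r"
    by (rule complex_algebra_flag_mult)
  \<comment> \<open>Once the vanishing factor is substituted, the identity is polynomial arithmetic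
    in coordinates.\<close>
  consider "a = 0" | "r = 0" using assms(2) by auto
  then show ?thesis
    unfolding terminal_def fun_eq_iff
    by cases (simp_all add: assms(1) bracket_bil_bil_def bracket_lin_bil_def bracket_bil_vec_def
      vec4_eq_iff field_simps)
qed

lemma terminal_flag_mult_imp:
  assumes "complex_algebra.terminal (flag_mult a a' b b' c c' p q r s t)"
    and "a \<noteq> 0 \<or> b \<noteq> 0 \<or> c \<noteq> 0"
  shows "c = 0" "s = 0" "t = 0" "a * r = 0" "a \<noteq> 0 \<or> b \<noteq> 0" "c' = b * p + (b - a) * q / 3"
proof -
  let ?m = "flag_mult a a' b b' c c' p q r s t"
  interpret complex_algebra "(*s)" ?m
    by (rule complex_algebra_flag_mult)
  have T: "bracket_bil_bil (bracket_lin_bil (bracket_bil_vec ?m w) ?m) ?m x y z $ i = 0"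
    for w x y z i
    using assms(1) unfolding terminal_def by simp
  note T' = T[unfolded bracket_bil_bil_def bracket_lin_bil_def bracket_bil_vec_def]
  show "c = 0"
    using T'[of "e 1" "e 1" "e 1" "e 1" 3] by simp
  with assms(2) show ab: "a \<noteq> 0 \<or> b \<noteq> 0" by auto
  note T = T'[where i = 4, simplified \<open>c = 0\<close>]
  show "c' = b * p + (b - a) * q / 3"
    using T[of "e 1" "e 1" "e 1" "e 1"] by (simp add: field_simps)
  \<comment> \<open>Since \<open>a\<close> and \<open>b\<close> are not both zero, \<open>t\<close>
    vanishes once both squares annihilate it.\<close>
  have "a^2 * t = 0"
    using T[of "e 1" "e 1" "e 2" "e 2"] by (auto simp: power2_eq_square)
  moreover have "b^2 * t = 0"
    using T[of "e 2" "e 2" "e 1" "e 1"] by (auto simp: power2_eq_square)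
  ultimately show "t = 0" using ab by auto
  have 1: "- (a * r) = 2 * a * s"
    using T[of "e 1" "e 1" "e 2" "e 1"] by (simp add: algebra_simps)
  have 2: "- (a * r) = a * s + b * s"
    using T[of "e 1" "e 2" "e 1" "e 1"] by (simp add: algebra_simps)
  have 3: "a * r = b * s"
    using T[of "e 2" "e 1" "e 1" "e 1"] by (simp add: algebra_simps)
  \<comment> \<open>The first two equations give \<open>a * s = b * s\<close>; with the third, the
    first becomes \<open>3 * a * s = 0\<close>, so both \<open>a * s\<close> and
    \<open>b * s\<close> vanish.\<close>
  show "s = 0" using 1 2 3 ab by (auto simp: algebra_simps)
  then show "a * r = 0" using 3 by simp
qed

section \<open>Nilpotency and generation\<close>

context complex_algebra
begin

lemma mult_simps:
  "mult (x + y) z = mult x z + mult y z" "mult z (x + y) = mult z x + mult z y"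
  "mult (scale c x) z = scale c (mult x z)" "mult z (scale c x) = scale c (mult z x)"
  "mult 0 z = 0" "mult z 0 = 0"
  "mult (x - y) z = mult x z - mult y z" "mult z (x - y) = mult z x - mult z y"
proof -
  interpret l: Vector_Spaces.linear scale scale "\<lambda>x. mult x z" by (rule linear_mult_left)
  interpret r: Vector_Spaces.linear scale scale "\<lambda>x. mult z x" by (rule linear_mult_right)
  show "mult (x + y) z = mult x z + mult y z" "mult z (x + y) = mult z x + mult z y"
    "mult (scale c x) z = scale c (mult x z)" "mult z (scale c x) = scale c (mult z x)"
    "mult 0 z = 0" "mult z 0 = 0"
    "mult (x - y) z = mult x z - mult y z" "mult z (x - y) = mult z x - mult z y"
    by (rule l.add r.add l.scale r.scale l.zero r.zero l.diff r.diff)+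
qed

lemma alg_power_minimal:
  assumes "2 \<le> n" "subspace W"
    and "\<And>i j x y. \<lbrakk>1 \<le> i; 1 \<le> j; i + j = n; x \<in> alg_power i; y \<in> alg_power j\<rbrakk> \<Longrightarrow> mult x y \<in> W"
  shows "alg_power n \<subseteq> W"
proof -
  have "(\<Union>i\<in>{1..n-1}. {mult x y | x y. x \<in> alg_power i \<and> y \<in> alg_power (n - i)}) \<subseteq> W"
  proof clarsimp
    fix i x y assume "Suc 0 \<le> i" "i \<le> n - Suc 0" "x \<in> alg_power i" "y \<in> alg_power (n - i)"
    then show "mult x y \<in> W" using assms(1) by (intro assms(3)[of i "n - i"]) auto
  qed
  then show ?thesis
    unfolding alg_power.simps[of n] using assms(1,2) by (auto dest: span_minimal)
qed

lemma mult_in_alg_power: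
  assumes "1 \<le> i" "1 \<le> j" "x \<in> alg_power i" "y \<in> alg_power j"
  shows "mult x y \<in> alg_power (i + j)"
proof -
  have "mult x y \<in> (\<Union>l\<in>{1..i+j-1}. {mult x y | x y. x \<in> alg_power l \<and> y \<in> alg_power (i + j - l)})"
    using assms by (intro UN_I[of i]) auto
  then show ?thesis
    unfolding alg_power.simps[of "i + j"] using assms(1,2) by (auto intro: span_base)
qed

lemma alg_power_1: "alg_power (Suc 0) = UNIV"
  by (subst alg_power.simps) simp

text \<open>\<open>S\<close> need not be an ideal: take \<open>u\<close> in the last power not contained in \<open>S\<close>.\<close>

lemma ex_annihilator_mod:
  assumes "nilpotent" "subspace S" "S \<noteq> UNIV"
  obtains u where "u \<notin> S" "\<And>x. mult x u \<in> S" "\<And>x. mult u x \<in> S"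
proof -
  define n where "n = (LEAST n. alg_power n \<subseteq> S)"
  obtain N where "alg_power N = {0}" using assms(1) unfolding nilpotent_def by blast
  then have "alg_power N \<subseteq> S" using assms(2) by (simp add: subspace_0)
  then have n: "alg_power n \<subseteq> S"
    unfolding n_def by (rule LeastI)
  have least: "\<not> alg_power m \<subseteq> S" if "m < n" for m
    using that unfolding n_def by (rule not_less_Least)
  \<comment> \<open>This excludes the dummy index 0, so that the predecessor of \<open>n\<close> is
    at least 1, as \<open>mult_in_alg_power\<close> requires.\<close>
  have "alg_power 0 = UNIV" "alg_power 1 = UNIV"
    by (subst alg_power.simps; simp)+
  then have "2 \<le> n" using n assms(3) by (cases "n = 0 \<or> n = 1") auto
  then obtain m where m: "n = Suc m" "1 \<le> m" by (cases n) auto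
  then obtain u where u: "u \<in> alg_power m" "u \<notin> S" using least[of m] by auto
  have "mult x u \<in> S" "mult u x \<in> S" for x
    using mult_in_alg_power[of 1 m x u] mult_in_alg_power[of m 1 u x] u m n
    by (auto simp: alg_power_1)
  with u(2) show ?thesis by (rule that)
qed

lemma one_generatedI:
  assumes "\<And>S. subalgebra S \<Longrightarrow> g \<in> S \<Longrightarrow> S = UNIV"
  shows "one_generated"
proof -
  have "subalgebra hull {g} = UNIV"
    using assms unfolding hull_def by auto
  then show ?thesis unfolding one_generated_def by blast
qed

end

section \<open>Nilpotency and generation for the structure constants\<close>

text \<open>Giving \<open>e 1\<close>, \<open>e 2\<close>, \<open>e 3\<close> degrees 1, 2, 3, each
  of these coordinates vanishes on powers beyond its degree. The exponent is 6 because the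
  \<open>r\<close> term has degree 2 + 3 = 5, so \<open>e 4\<close> may survive up to the fifth
  power.\<close>

lemma nilpotent_flag_mult0:
  "complex_algebra.nilpotent (*s) (flag_mult0 a a' b b' c' p q r)"
proof -
  interpret complex_algebra "(*s)" "flag_mult0 a a' b b' c' p q r"
    by (rule complex_algebra_flag_mult)
  have 2: "x$1 = 0" if "x \<in> alg_power n" "2 \<le> n" for x n
  proof -
    have "vec.subspace {x :: complex^4. x$1 = 0}" by (auto simp: vec.subspace_def)
    from alg_power_minimal[OF that(2) this] that(1) show ?thesis by auto
  qed
  have 3: "x$2 = 0" if "x \<in> alg_power n" "3 \<le> n" for x n
  proof -
    have "vec.subspace {x :: complex^4. x$2 = 0}" by (auto simp: vec.subspace_def)
    moreover have "flag_mult0 a a' b b' c' p q r x y \<in> {x. x$2 = 0}"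
      if "i + j = n" "x \<in> alg_power i" "y \<in> alg_power j" for i j x y
    proof -
      have "2 \<le> i \<or> 2 \<le> j" using that(1) \<open>3 \<le> n\<close> by linarith
      with 2 that show ?thesis by auto
    qed
    ultimately have "alg_power n \<subseteq> {x. x$2 = 0}"
      using \<open>3 \<le> n\<close> by (intro alg_power_minimal) auto
    with that(1) show ?thesis by auto
  qed
  have 4: "x$3 = 0" if "x \<in> alg_power n" "4 \<le> n" for x n
  proof -
    have "vec.subspace {x :: complex^4. x$3 = 0}" by (auto simp: vec.subspace_def)
    moreover have "flag_mult0 a a' b b' c' p q r x y \<in> {x. x$3 = 0}"
      if "i + j = n" "x \<in> alg_power i" "y \<in> alg_power j" for i j x y
    proof -
      have "2 \<le> i \<or> 3 \<le> j" "3 \<le> i \<or> 2 \<le> j" using that(1) \<open>4 \<le> n\<close> by linarith+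
      with 2 3 that show ?thesis by auto
    qed
    ultimately have "alg_power n \<subseteq> {x. x$3 = 0}"
      using \<open>4 \<le> n\<close> by (intro alg_power_minimal) auto
    with that(1) show ?thesis by auto
  qed
  have "alg_power 6 \<subseteq> {0}"
  proof (rule alg_power_minimal)
    fix i j x y
    assume *: "i + j = 6" "x \<in> alg_power i" "y \<in> alg_power j"
    \<comment> \<open>One disjunction for each monomial of the product: its two degrees add up to at
      most 5, so one of \<open>i\<close>, \<open>j\<close> exceeds the degree of its factor.\<close>
    have "2 \<le> i \<or> 2 \<le> j" "2 \<le> i \<or> 3 \<le> j" "3 \<le> i \<or> 2 \<le> j" "3 \<le> i \<or> 3 \<le> j"
      "2 \<le> i \<or> 4 \<le> j" "4 \<le> i \<or> 2 \<le> j" "3 \<le> i \<or> 4 \<le> j"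
      using *(1) by linarith+
    then have "x$1 = 0 \<or> y$1 = 0" "x$1 = 0 \<or> y$2 = 0" "x$2 = 0 \<or> y$1 = 0" "x$2 = 0 \<or> y$2 = 0"
      "x$1 = 0 \<or> y$3 = 0" "x$3 = 0 \<or> y$1 = 0" "x$2 = 0 \<or> y$3 = 0"
      using 2[OF *(2)] 2[OF *(3)] 3[OF *(2)] 3[OF *(3)] 4[OF *(2)] 4[OF *(3)] by blast+
    then show "flag_mult0 a a' b b' c' p q r x y \<in> {0}"
      by (auto simp: vec4_eq_iff)
  qed (auto simp: vec.subspace_def)
  moreover have "0 \<in> alg_power 6"
    by (subst alg_power.simps) (simp add: vec.span_zero)
  ultimately show ?thesis
    unfolding nilpotent_def by (intro exI[of _ 6]) auto
qed

text \<open>Products of \<open>e 1\<close>, its square \<open>e 2\<close>, \<open>u\<close> and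
  \<open>v\<close> yield several multiples of \<open>e 4\<close>, and the hypothesis makes one of
  them nonzero. Removing the \<open>e 4\<close> parts of \<open>u\<close> and \<open>v\<close> then
  leaves multiples of \<open>e 3\<close> that are not both zero.\<close>

lemma one_generated_flag_mult0:
  assumes "a * b' \<noteq> b * a' \<or> (a \<noteq> 0 \<or> b \<noteq> 0) \<and> (c' \<noteq> 0 \<or> p \<noteq> 0 \<or> q \<noteq> 0 \<or> r \<noteq> 0)"
  shows "complex_algebra.one_generated (*s) (flag_mult0 a a' b b' c' p q r)"
proof -
  let ?m = "flag_mult0 a a' b b' c' p q r"
  interpret complex_algebra "(*s)" ?m
    by (rule complex_algebra_flag_mult)
  show ?thesis
  proof (rule one_generatedI)
    fix S assume S: "subalgebra S" and e1: "e 1 \<in> S"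
    have sub: "vec.subspace S" and mult: "\<And>x y. x \<in> S \<Longrightarrow> y \<in> S \<Longrightarrow> ?m x y \<in> S"
      using S unfolding subalgebra_def by auto
    have div: "x \<in> S" if "k *s x \<in> S" "k \<noteq> 0" for k x
      using vec.subspace_scale[OF sub that(1), of "1 / k"] that(2) by simp
    have "?m (e 1) (e 1) = e 2" by (simp add: vec4_eq_iff)
    then have e2: "e 2 \<in> S" using mult[OF e1 e1] by simp
    define u v where "u = a *s e 3 + a' *s e 4" and "v = b *s e 3 + b' *s e 4"
    have "?m (e 1) (e 2) = u" "?m (e 2) (e 1) = v" by (simp_all add: vec4_eq_iff u_def v_def)
    then have u: "u \<in> S" and v: "v \<in> S" using mult[OF e1 e2] mult[OF e2 e1] by simp_all
    have "?m (e 2) (e 2) = c' *s e 4" "?m (e 1) u = (p * a) *s e 4" "?m u (e 1) = (q * a) *s e 4"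
      "?m (e 2) u = (r * a) *s e 4" "?m (e 1) v = (p * b) *s e 4" "?m v (e 1) = (q * b) *s e 4"
      "?m (e 2) v = (r * b) *s e 4" "a *s v - b *s u = (a * b' - b * a') *s e 4"
      by (simp_all add: vec4_eq_iff u_def v_def)
    then have "c' *s e 4 \<in> S" "(p * a) *s e 4 \<in> S" "(q * a) *s e 4 \<in> S" "(r * a) *s e 4 \<in> S"
       "(p * b) *s e 4 \<in> S" "(q * b) *s e 4 \<in> S" "(r * b) *s e 4 \<in> S"
       "(a * b' - b * a') *s e 4 \<in> S"
      using mult e1 e2 u v sub by (metis vec.subspace_diff vec.subspace_scale)+
    with assms have e4: "e 4 \<in> S" by (metis div mult_eq_0_iff right_minus_eq)
    have "a *s e 3 = u - a' *s e 4" "b *s e 3 = v - b' *s e 4" by (simp_all add: u_def v_def)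
    then have "a *s e 3 \<in> S" "b *s e 3 \<in> S"
      using u v e4 sub by (simp_all add: vec.subspace_diff vec.subspace_scale)
    moreover have "a \<noteq> 0 \<or> b \<noteq> 0" using assms by auto
    ultimately have e3: "e 3 \<in> S" using div by blast
    show "S = UNIV"
      using e1 e2 e3 e4 sub by (subst set_eq_iff, subst vec4_expand)
        (simp add: vec.subspace_add vec.subspace_scale)
  qed
qed

lemma T_list_in_class:
  assumes "Q \<in> T_list"
  shows "one_gen_nilp_term_alg4 (*s) Q"
proof -
  have "vec.dim (UNIV :: (complex^4) set) = 4"
    unfolding vec_dim_card by simp
  then have *: "one_gen_nilp_term_alg4 (*s) (flag_mult0 a a' b b' c' p q r)"
    if "a * b' \<noteq> b * a' \<or> (a \<noteq> 0 \<or> b \<noteq> 0) \<and> (c' \<noteq> 0 \<or> p \<noteq> 0 \<or> q \<noteq> 0 \<or> r \<noteq> 0)"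
      "c' = b * p + (b - a) * q / 3" "a * r = 0" for a a' b b' c' p q r
    unfolding one_gen_nilp_term_alg4_def
    by (intro conjI complex_algebra_flag_mult one_generated_flag_mult0 nilpotent_flag_mult0
        terminal_flag_mult0 that)
  from assms show ?thesis
    unfolding T_list_def by (auto simp: T_eq_flag_mult intro!: *)
qed

section \<open>Infinitely many isomorphism classes\<close>

lemma T05_isomorphic_imp_eq:
  assumes "algebra_isomorphic (*s) (T05 \<mu> \<alpha>) (*s) (T05 \<nu> \<beta>)"
  shows "\<mu> = \<nu>"
proof -
  obtain f where f: "Vector_Spaces.linear (*s) (*s) f" "bij f"
      "\<And>x y. f (T05 \<mu> \<alpha> x y) = T05 \<nu> \<beta> (f x) (f y)"
    using assms unfolding algebra_isomorphic_def by blast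
  interpret f: Vector_Spaces.linear "(*s)" "(*s)" f by fact
  \<comment> \<open>For \<open>x\<close> in \<open>T05 \<mu> \<alpha>\<close> the \<open>e 3\<close>
    parts cancel, so \<open>D\<close> takes values in the annihilating line of \<open>e 4\<close>.
    In \<open>T05 \<nu> \<beta>\<close> the \<open>e 3\<close> part of \<open>D\<close> at
    \<open>e 1\<close> is \<open>\<nu> - \<mu>\<close>, which multiplication by \<open>e 1\<close>
    moves to \<open>e 4\<close>.\<close>
  define D where "D P x = P x (P x x) - \<mu> *s P (P x x) x" for P and x :: "complex^4"
  have "T05 \<mu> \<alpha> (D (T05 \<mu> \<alpha>) x) y = 0" for x y
    by (simp add: D_def T_eq_flag_mult vec4_eq_iff algebra_simps)
  moreover have "f (T05 \<mu> \<alpha> (D (T05 \<mu> \<alpha>) x) y) = T05 \<nu> \<beta> (D (T05 \<nu> \<beta>) (f x)) (f y)" for x y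
    by (simp add: D_def f.diff f.scale f(3))
  ultimately have "T05 \<nu> \<beta> (D (T05 \<nu> \<beta>) (f x)) (f y) = 0" for x y
    using f.zero by metis
  then have "T05 \<nu> \<beta> (D (T05 \<nu> \<beta>) (e 1)) (e 1) = 0"
    using f(2) by (metis bij_pointE)
  then show ?thesis
    by (simp add: D_def T_eq_flag_mult vec4_eq_iff)
qed

lemma infinite_iso_classes: "infinite (algs4 // iso_rel4)"
proof -
  have mem: "T05 \<mu> 0 \<in> algs4" for \<mu>
  proof -
    have "T05 \<mu> 0 \<in> T_list" unfolding T_list_def by blast
    then show ?thesis unfolding algs4_def using T_list_in_class by blast
  qed
  have "inj (\<lambda>\<mu>. iso_rel4 `` {T05 \<mu> 0})"
  proof (rule injI)
    fix \<mu> \<nu> assume eq: "iso_rel4 `` {T05 \<mu> 0} = iso_rel4 `` {T05 \<nu> 0}"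
    have "T05 \<nu> 0 \<in> iso_rel4 `` {T05 \<nu> 0}"
      unfolding iso_rel4_def using mem algebra_isomorphic_refl vec.vector_space_axioms by blast
    then have "algebra_isomorphic (*s) (T05 \<mu> 0) (*s) (T05 \<nu> 0)"
      unfolding eq[symmetric] by (simp add: iso_rel4_def)
    then show "\<mu> = \<nu>" by (rule T05_isomorphic_imp_eq)
  qed
  then have "infinite (range (\<lambda>\<mu>. iso_rel4 `` {T05 \<mu> 0}))"
    using finite_imageD infinite_UNIV_char_0 by blast
  moreover have "range (\<lambda>\<mu>. iso_rel4 `` {T05 \<mu> 0}) \<subseteq> algs4 // iso_rel4"
    using mem by (auto intro: quotientI)
  ultimately show ?thesis using finite_subset by blast
qed

section \<open>Coordinates adapted to a flag\<close>

context complex_algebra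
begin

lemma span_insert_iff: "x \<in> span (insert a S) \<longleftrightarrow> (\<exists>k. \<exists>y\<in>span S. x = scale k a + y)"
  unfolding span_breakdown_eq
  by (metis add.commute diff_add_cancel add_diff_cancel)

text \<open>The induction step of the flag: the enlarged span is not just an ideal, its products
  already fall into the smaller one.\<close>

lemma ideal_insert:
  assumes "\<And>x y. y \<in> span S \<Longrightarrow> mult x y \<in> span S \<and> mult y x \<in> span S"
    and "\<And>x. mult x u \<in> span S" "\<And>x. mult u x \<in> span S"
    and "y \<in> span (insert u S)"
  shows "mult x y \<in> span S" "mult y x \<in> span S"
  using assms unfolding span_insert_iff
  by (auto simp: mult_simps intro!: span_add span_scale)

text \<open>Repeated use of \<open>ex_annihilator_mod\<close> gives \<open>v\<close>,
  \<open>u\<close>, \<open>w\<close>, \<open>z\<close>. The last two only bound products and are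
  then replaced by the square of the generator \<open>g\<close> and by \<open>g\<close> itself; if
  these were not independent modulo the flag, \<open>g\<close> would lie in a proper
  subalgebra.\<close>

lemma ex_flag_basis:
  assumes dim: "dim (UNIV :: 'v set) = 4" and "one_generated" "nilpotent"
  obtains g u v where "\<And>S. subalgebra S \<Longrightarrow> g \<in> S \<Longrightarrow> S = UNIV"
    "independent {g, mult g g, u, v}" "span {g, mult g g, u, v} = UNIV"
    "distinct [g, mult g g, u, v]"
    "\<And>x. mult x v = 0" "\<And>x. mult v x = 0"
    "\<And>x. mult x u \<in> span {v}" "\<And>x. mult u x \<in> span {v}"
    "\<And>x. mult x (mult g g) \<in> span {u, v}" "\<And>x. mult (mult g g) x \<in> span {u, v}"
proof -
  obtain g where "subalgebra hull {g} = UNIV" using assms(2) unfolding one_generated_def by blast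
  then have g: "S = UNIV" if "subalgebra S" "g \<in> S" for S
    using that unfolding hull_def by auto
  have small: "span X \<noteq> UNIV" if "independent X" "card X < 4" for X
    using dim_eq_card[of X UNIV] that dim by auto
  obtain B where B: "independent B" "span B = UNIV" "card B = 4"
    \<comment> \<open>A finite basis makes the finite-dimensional theory available, which turns four
      independent vectors into a spanning set.\<close>
    using basis_exists[of UNIV] dim by (metis span_eq_iff subspace_UNIV span_mono top.extremum_uniqueI)
  then interpret finite_dimensional_vector_space scale B
    by unfold_locales (auto intro: card_ge_0_finite)
  have full: "span X = UNIV" if "independent X" "card X = 4" for X
    using card_ge_dim_independent[of X UNIV] that dim by auto
  obtain v where v: "v \<noteq> 0" "\<And>x. mult x v = 0" "\<And>x. mult v x = 0"
    using ex_annihilator_mod[OF assms(3), of "{0}"] small[of "{}"] independent_empty by auto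
  have iv: "independent {v}" using v(1) by simp
  have I3: "mult x y = 0" "mult y x = 0" if "y \<in> span {v}" for x y
    using ideal_insert[of "{}" v y x] that v(2,3) by (auto simp: mult_simps)
  obtain u where u: "u \<notin> span {v}" "\<And>x. mult x u \<in> span {v}" "\<And>x. mult u x \<in> span {v}"
    using ex_annihilator_mod[OF assms(3), of "span {v}"] small[OF iv] by auto
  have iu: "independent {u, v}" using u(1) iv by (simp add: independent_insertI)
  have uv: "u \<noteq> v" using u(1) by (auto intro: span_base)
  have I2: "mult x y \<in> span {v}" "mult y x \<in> span {v}" if "y \<in> span {u, v}" for x y
    using ideal_insert[of "{v}" u y x] that u(2,3) I3 by (auto simp: span_zero)
  have mono: "span {v} \<subseteq> span {u, v}" "span {u, v} \<subseteq> span {w, u, v}" for w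
    by (auto intro!: span_mono)
  obtain w where w: "w \<notin> span {u, v}" "\<And>x. mult x w \<in> span {u, v}" "\<And>x. mult w x \<in> span {u, v}"
    using ex_annihilator_mod[OF assms(3), of "span {u, v}"] small[OF iu] uv by auto
  have iw: "independent {w, u, v}" using w(1) iu by (simp add: independent_insertI)
  have wuv: "w \<noteq> u" "w \<noteq> v" using w(1) by (auto intro: span_base)
  have I1: "mult x y \<in> span {u, v}" "mult y x \<in> span {u, v}" if "y \<in> span {w, u, v}" for x y
  proof -
    have "mult x y \<in> span {u, v} \<and> mult y x \<in> span {u, v}" if "y \<in> span {u, v}" for x y
      using I2[OF that] mono(1) by blast
    from ideal_insert[OF this w(2,3) that]
    show "mult x y \<in> span {u, v}" "mult y x \<in> span {u, v}" by auto
  qed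
  obtain z where z: "z \<notin> span {w, u, v}" "\<And>x. mult x z \<in> span {w, u, v}" "\<And>x. mult z x \<in> span {w, u, v}"
    using ex_annihilator_mod[OF assms(3), of "span {w, u, v}"] small[OF iw] uv wuv by auto
  have iz: "independent {z, w, u, v}" using z(1) iw by (simp add: independent_insertI)
  have zwuv: "z \<noteq> w" "z \<noteq> u" "z \<noteq> v" using z(1) by (auto intro: span_base)
  have I0: "mult x y \<in> span {w, u, v}" "mult y x \<in> span {w, u, v}"
    if "y \<in> span {z, w, u, v}" for x y
  proof -
    have "mult x y \<in> span {w, u, v} \<and> mult y x \<in> span {w, u, v}" if "y \<in> span {w, u, v}" for x y
      using I1[OF that] mono(2) by blast
    from ideal_insert[OF this z(2,3) that]
    show "mult x y \<in> span {w, u, v}" "mult y x \<in> span {w, u, v}" by auto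
  qed
  have "span {z, w, u, v} = UNIV" using iz full uv wuv zwuv by simp
  then have prod: "mult x y \<in> span {w, u, v}" for x y using I0 by blast
  let ?h = "mult g g"
  have "subalgebra (span {w, u, v})" unfolding subalgebra_def using prod by auto
  then have g_out: "g \<notin> span {w, u, v}" using g small[OF iw] uv wuv by auto
  \<comment> \<open>Otherwise \<open>span {g, u, v}\<close> would be a three-dimensional subalgebra
    containing the generator.\<close>
  have h_out: "?h \<notin> span {u, v}"
  proof
    assume h: "?h \<in> span {u, v}"
    have g1: "g \<notin> span {u, v}" using g_out mono(2) by blast
    then have ig: "independent {g, u, v}" using iu by (simp add: independent_insertI)
    have "g \<noteq> u" "g \<noteq> v" using g1 by (auto intro: span_base)
    then have ne: "span {g, u, v} \<noteq> UNIV" using small[OF ig] uv by auto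
    have "mult x y \<in> span {g, u, v}" if xy: "x \<in> span {g, u, v}" "y \<in> span {g, u, v}" for x y
    proof -
      obtain k x' l y' where "x = scale k g + x'" "x' \<in> span {u, v}" "y = scale l g + y'" "y' \<in> span {u, v}"
        using xy unfolding span_insert_iff[of _ g] by blast
      then have "mult x y \<in> span {u, v}"
        using h I2 mono(1) by (auto simp: mult_simps intro!: span_add span_scale)
      with mono(2) show ?thesis by blast
    qed
    then have "subalgebra (span {g, u, v})" unfolding subalgebra_def by auto
    with g ne show False by (auto intro: span_base)
  qed
  have ih: "independent {?h, u, v}" using h_out iu by (simp add: independent_insertI)
  have "span {?h, u, v} \<subseteq> span {w, u, v}"
    using prod mono(2) by (intro span_minimal) (auto intro: span_base)
  then have g2: "g \<notin> span {?h, u, v}" using g_out by blast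
  have ig: "independent {g, ?h, u, v}" using ih g2 by (simp add: independent_insertI)
  have "distinct [g, ?h, u, v]" using h_out g2 uv by (auto intro: span_base)
  moreover from this have "span {g, ?h, u, v} = UNIV" using full[OF ig] by simp
  ultimately show ?thesis
    \<comment> \<open>The square of \<open>g\<close> is a product, so it lies in
      \<open>span {w, u, v}\<close> and inherits the bound of \<open>I1\<close>.\<close>
    by (intro that[OF g ig _ _ v(2,3) u(2,3) I1[OF prod]])
qed

end

text \<open>The second conclusion keeps track of \<open>e 1\<close> as a generator; this is what
  later excludes degenerate structure constants.\<close>

lemma ex_isomorphic_flag_mult:
  assumes "complex_algebra sc P" "vector_space.dim sc (UNIV :: 'v::ab_group_add set) = 4"
    "complex_algebra.one_generated sc P" "complex_algebra.nilpotent sc P"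
  obtains a a' b b' c c' p q r s t where
    "algebra_isomorphic (*s) (flag_mult a a' b b' c c' p q r s t) sc P"
    "\<And>S. complex_algebra.subalgebra (*s) (flag_mult a a' b b' c c' p q r s t) S \<Longrightarrow> e 1 \<in> S \<Longrightarrow> S = UNIV"
proof -
  interpret complex_algebra sc P by fact
  obtain g u v where gen: "\<And>S. subalgebra S \<Longrightarrow> g \<in> S \<Longrightarrow> S = UNIV"
    and ind: "independent {g, P g g, u, v}" and span: "span {g, P g g, u, v} = UNIV"
    and dist: "distinct [g, P g g, u, v]"
    and v: "\<And>x. P x v = 0" "\<And>x. P v x = 0"
    and u: "\<And>x. P x u \<in> span {v}" "\<And>x. P u x \<in> span {v}"
    and gg: "\<And>x. P x (P g g) \<in> span {u, v}" "\<And>x. P (P g g) x \<in> span {u, v}"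
    using ex_flag_basis[OF assms(2-4)] by blast
  let ?h = "P g g"
  have 1: "\<exists>k. x = sc k v" if "x \<in> span {v}" for x
    using that by (auto simp: span_singleton)
  have 2: "\<exists>k l. x = sc k u + sc l v" if "x \<in> span {u, v}" for x
    using that by (auto simp: span_insert_iff span_singleton)
  obtain a a' where a: "P g ?h = sc a u + sc a' v" using 2 gg by blast
  obtain b b' where b: "P ?h g = sc b u + sc b' v" using 2 gg by blast
  obtain c c' where c: "P ?h ?h = sc c u + sc c' v" using 2 gg by blast
  obtain p where p: "P g u = sc p v" using 1 u by blast
  obtain q where q: "P u g = sc q v" using 1 u by blast
  obtain r where r: "P ?h u = sc r v" using 1 u by blast
  obtain s where s: "P u ?h = sc s v" using 1 u by blast
  obtain t where t: "P u u = sc t v" using 1 u by blast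
  let ?m = "flag_mult a a' b b' c c' p q r s t"
  define f where "f x = sc (x$1) g + sc (x$2) ?h + sc (x$3) u + sc (x$4) v" for x :: "complex^4"
  have lin: "Vector_Spaces.linear (*s) sc f"
    unfolding Vector_Spaces.linear_iff using vector_space_axioms vec.vector_space_axioms
    by (auto simp: f_def scale_left_distrib scale_right_distrib)
  interpret f: Vector_Spaces.linear "(*s)" sc f by fact
  have hom: "f (?m x y) = P (f x) (f y)" for x y
    unfolding f_def
    by (simp add: mult_simps a b c p q r s t v scale_left_distrib scale_right_distrib algebra_simps)
  have "x = 0" if "f x = 0" for x
  proof -
    have ne: "?h \<noteq> g" "u \<noteq> g" "v \<noteq> g" "u \<noteq> ?h" "v \<noteq> ?h" "v \<noteq> u" using dist by auto
    \<comment> \<open>The coordinates as a function on the basis set, the form in which independence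
      is applied.\<close>
    define w where "w y = (if y = g then x$1 else if y = ?h then x$2 else if y = u then x$3 else x$4)" for y
    have "(\<Sum>y\<in>{g, ?h, u, v}. sc (w y) y) = 0"
      using that ne ne[symmetric] by (simp add: f_def w_def add.assoc)
    then have "w y = 0" if "y \<in> {g, ?h, u, v}" for y
      using independentD[OF ind _ subset_refl] that by blast
    from this[of g] this[of ?h] this[of u] this[of v] show "x = 0"
      using ne by (simp add: w_def vec4_eq_iff)
  qed
  then have "inj f"
    by (intro injI) (metis f.diff right_minus_eq)
  moreover have "\<exists>x. f x = y" for y
  proof -
    obtain k1 y1 where 3: "y = sc k1 g + y1" "y1 \<in> span {?h, u, v}"
      using UNIV_I[of y] unfolding span[symmetric] span_insert_iff[of _ g] by blast
    then obtain k2 y2 where 4: "y1 = sc k2 ?h + y2" "y2 \<in> span {u, v}"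
      unfolding span_insert_iff[of _ ?h] by blast
    then obtain k3 k4 where "y2 = sc k3 u + sc k4 v" using 2 by blast
    with 3 4 have "f (k1 *s e 1 + k2 *s e 2 + k3 *s e 3 + k4 *s e 4) = y"
      by (simp add: f_def add.assoc)
    then show ?thesis ..
  qed
  ultimately have bij: "bij f" by (auto simp: bij_def surj_def) metis
  have iso: "algebra_isomorphic (*s) ?m sc P"
    unfolding algebra_isomorphic_def using lin bij hom by blast
  interpret m: complex_algebra "(*s)" ?m by (rule complex_algebra_flag_mult)
  have "S = UNIV" if S: "m.subalgebra S" "e 1 \<in> S" for S
  proof -
    have "subalgebra (f ` S)"
      using S(1) f.subspace_image unfolding subalgebra_def m.subalgebra_def by (auto simp flip: hom)
    moreover have "f (e 1) = g" by (simp add: f_def)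
    ultimately have "f ` S = UNIV" using gen S(2) by blast
    then show ?thesis using bij by (metis bij_betw_def inj_image_eq_iff)
  qed
  with iso show ?thesis by (rule that)
qed

section \<open>Transfer of terminality and consequences of generation\<close>

lemma terminal_isomorphic:
  assumes "algebra_isomorphic sc P sd Q" "complex_algebra sc P" "complex_algebra sd Q"
    and "complex_algebra.terminal Q"
  shows "complex_algebra.terminal P"
proof -
  interpret P: complex_algebra sc P by fact
  interpret Q: complex_algebra sd Q by fact
  obtain f where f: "Vector_Spaces.linear sc sd f" "bij f" "\<And>x y. f (P x y) = Q (f x) (f y)"
    using assms(1) unfolding algebra_isomorphic_def by blast
  interpret f: Vector_Spaces.linear sc sd f by fact
  have "f (bracket_bil_bil (bracket_lin_bil (bracket_bil_vec P a) P) P x y z) =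
      bracket_bil_bil (bracket_lin_bil (bracket_bil_vec Q (f a)) Q) Q (f x) (f y) (f z)" for a x y z
    by (simp add: bracket_bil_bil_def bracket_lin_bil_def bracket_bil_vec_def f.add f.diff f(3))
  \<comment> \<open>The right-hand side is \<open>f 0\<close> so that injectivity of
    \<open>f\<close> can be applied at the end.\<close>
  also have "\<dots> a x y z = f 0" for a x y z
    using assms(4) f.zero unfolding Q.terminal_def by simp
  finally have "bracket_bil_bil (bracket_lin_bil (bracket_bil_vec P a) P) P x y z = 0" for a x y z
    by (rule injD[OF bij_is_inj[OF f(2)]])
  then show ?thesis
    unfolding P.terminal_def by (simp add: fun_eq_iff)
qed

lemma flag_mult_generated_imp:
  assumes "\<And>S. complex_algebra.subalgebra (*s) (flag_mult a a' b b' c c' p q r s t) S \<Longrightarrow> e 1 \<in> S \<Longrightarrow> S = UNIV"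
  shows "a \<noteq> 0 \<or> b \<noteq> 0 \<or> c \<noteq> 0"
    and "c = 0 \<Longrightarrow> c' = 0 \<Longrightarrow> p = 0 \<Longrightarrow> q = 0 \<Longrightarrow> r = 0 \<Longrightarrow> s = 0 \<Longrightarrow> t = 0 \<Longrightarrow> a * b' \<noteq> b * a'"
proof -
  interpret complex_algebra "(*s)" "flag_mult a a' b b' c c' p q r s t"
    by (rule complex_algebra_flag_mult)
  show abc: "a \<noteq> 0 \<or> b \<noteq> 0 \<or> c \<noteq> 0"
  proof (rule ccontr)
    assume "\<not> ?thesis"
    \<comment> \<open>With \<open>a = b = c = 0\<close> no product has an \<open>e 3\<close> part,
      so this hyperplane is closed and contains \<open>e 1\<close>.\<close>
    then have "subalgebra {x. x$3 = 0}"
      unfolding subalgebra_def vec.subspace_def by auto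
    from assms[OF this] have "e 3 \<in> {x. x$3 = 0}" by auto
    then show False by simp
  qed
  show "a * b' \<noteq> b * a'" if "c = 0" "c' = 0" "p = 0" "q = 0" "r = 0" "s = 0" "t = 0"
  proof
    assume *: "a * b' = b * a'"
    \<comment> \<open>If \<open>(a, a')\<close> and \<open>(b, b')\<close> are proportional, then
      \<open>e 1\<close>, \<open>e 2\<close> and their common direction span a subalgebra. It misses
      \<open>e 4\<close> because \<open>a\<close> or \<open>b\<close> is nonzero.\<close>
    have "subalgebra {x. b * x$4 = b' * x$3 \<and> a * x$4 = a' * x$3}"
      unfolding subalgebra_def vec.subspace_def using * that by (auto simp: algebra_simps)
    from assms[OF this] have "e 4 \<in> {x. b * x$4 = b' * x$3 \<and> a * x$4 = a' * x$3}" by auto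
    with abc that show False by simp
  qed
qed

section \<open>Classification\<close>

text \<open>Passing to the generator \<open>w\<^sub>1 = k e\<^sub>1 + x e\<^sub>2\<close> and to \<open>w\<^sub>2 = w\<^sub>1w\<^sub>1\<close>, \<open>w\<^sub>3 = m e\<^sub>3 + n e\<^sub>4\<close>,
  \<open>w\<^sub>4 = d e\<^sub>4\<close> changes the structure constants as follows.\<close>

lemma flag_mult0_isomorphic:
  fixes a a' b b' c' p q r a1 a1' b1 b1' c1' p1 q1 r1 k x m n d :: complex
  assumes nz: "k \<noteq> 0" "m \<noteq> 0" "d \<noteq> 0"
    and "a1 * m = k^3 * a" "b1 * m = k^3 * b"
    and "a1 * n + a1' * d = k^3 * a' + k^2 * x * (a + b) * p + k^2 * x * c' + k * x^2 * (a + b) * r"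
    and "b1 * n + b1' * d = k^3 * b' + k^2 * x * c' + k^2 * x * (a + b) * q"
    and "c1' * d = k^4 * c' + k^3 * x * (a + b) * r"
    and "p1 * d = m * (k * p + x * r)" "q1 * d = m * k * q" "r1 * d = k^2 * m * r"
  shows "algebra_isomorphic (*s) (flag_mult0 a a' b b' c' p q r)
    (*s) (flag_mult0 a1 a1' b1 b1' c1' p1 q1 r1)"
\<comment> \<open>The map sends the standard basis to the new basis vectors, hence goes from the new
  algebra to the old one.\<close>
proof (rule algebra_isomorphic_sym, rule linear_inj_imp_isomorphic)
  let ?G = "flag_mult0 a a' b b' c' p q r" and ?G1 = "flag_mult0 a1 a1' b1 b1' c1' p1 q1 r1"
  \<comment> \<open>The \<open>e 4\<close> part of the square of
    \<open>k *s e 1 + x *s e 2\<close>.\<close>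
  define w where "w = k * x * (a' + b') + x^2 * c'"
  define f where "f y = (k * y$1) *s e 1 + (x * y$1 + k^2 * y$2) *s e 2 +
    (k * x * (a + b) * y$2 + m * y$3) *s e 3 + (w * y$2 + n * y$3 + d * y$4) *s e 4" for y :: "complex^4"
  have f_nth: "f y $ 1 = k * y$1" "f y $ 2 = x * y$1 + k^2 * y$2"
    "f y $ 3 = k * x * (a + b) * y$2 + m * y$3" "f y $ 4 = w * y$2 + n * y$3 + d * y$4" for y
    by (simp_all add: f_def)
  show "Vector_Spaces.linear (*s) (*s) f"
    unfolding Vector_Spaces.linear_iff using vec.vector_space_axioms
    by (auto simp: vec4_eq_iff f_nth algebra_simps)
  show "y = 0" if "f y = 0" for y
    using that nz by (auto simp: vec4_eq_iff f_nth)
  show "f (?G1 y z) = ?G (f y) (f z)" for y z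
  proof -
    have "f (?G1 y z) $ 3 = k * x * (a + b) * y$1 * z$1 + (a1 * m) * y$1 * z$2 + (b1 * m) * y$2 * z$1"
      by (simp add: f_nth algebra_simps)
    also have "\<dots> = ?G (f y) (f z) $ 3"
      unfolding assms by (simp add: f_nth algebra_simps power2_eq_square power3_eq_cube)
    finally have 3: "f (?G1 y z) $ 3 = ?G (f y) (f z) $ 3" .
    have "f (?G1 y z) $ 4 = w * y$1 * z$1 + (a1 * n + a1' * d) * y$1 * z$2 +
        (b1 * n + b1' * d) * y$2 * z$1 + (c1' * d) * y$2 * z$2 + (p1 * d) * y$1 * z$3 +
        (q1 * d) * y$3 * z$1 + (r1 * d) * y$2 * z$3"
      by (simp add: f_nth algebra_simps)
    also have "\<dots> = ?G (f y) (f z) $ 4"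
      unfolding assms by (simp add: f_nth w_def algebra_simps power2_eq_square power3_eq_cube power4_eq_xxxx)
    finally have 4: "f (?G1 y z) $ 4 = ?G (f y) (f z) $ 4" .
    show ?thesis
      unfolding vec4_eq_iff 3 4 by (simp add: f_nth algebra_simps power2_eq_square)
  qed
qed

text \<open>Here \<open>e 3\<close> and \<open>e 4\<close> are sent to the products
  \<open>e 2\<close> by \<open>e 1\<close> and \<open>e 1\<close> by \<open>e 2\<close>. A separate
  map is needed since \<open>flag_mult0_isomorphic\<close> preserves the line of
  \<open>e 4\<close>.\<close>

lemma flag_mult0_isomorphic_T01:
  assumes "a * b' \<noteq> b * a'"
  shows "algebra_isomorphic (*s) (flag_mult0 a a' b b' 0 0 0 0) (*s) T01"
  unfolding T_eq_flag_mult
proof (rule algebra_isomorphic_sym, rule linear_inj_imp_isomorphic)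
  let ?G = "flag_mult0 a a' b b' 0 0 0 0" and ?G1 = "flag_mult0 0 1 1 0 0 0 0 0"
  define f where "f y = (y$1) *s e 1 + (y$2) *s e 2 + (b * y$3 + a * y$4) *s e 3 +
    (b' * y$3 + a' * y$4) *s e 4" for y :: "complex^4"
  have f_nth: "f y $ 1 = y$1" "f y $ 2 = y$2"
    "f y $ 3 = b * y$3 + a * y$4" "f y $ 4 = b' * y$3 + a' * y$4" for y
    by (simp_all add: f_def)
  show "Vector_Spaces.linear (*s) (*s) f"
    unfolding Vector_Spaces.linear_iff using vec.vector_space_axioms
    by (auto simp: vec4_eq_iff f_nth algebra_simps)
  show "f (?G1 y z) = ?G (f y) (f z)" for y z
    by (simp add: vec4_eq_iff f_nth)
  show "y = 0" if "f y = 0" for y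
  proof -
    from that have 0: "b * y$3 + a * y$4 = 0" "b' * y$3 + a' * y$4 = 0" "y$1 = 0" "y$2 = 0"
      by (simp_all add: vec4_eq_iff f_nth)
    \<comment> \<open>Cramer's rule for the two equations in \<open>y$3\<close> and
      \<open>y$4\<close>.\<close>
    have "(a * b' - b * a') * y$3 = a * (b' * y$3 + a' * y$4) - a' * (b * y$3 + a * y$4)"
      "(a * b' - b * a') * y$4 = b' * (b * y$3 + a * y$4) - b * (b' * y$3 + a' * y$4)"
      by (simp_all add: algebra_simps)
    then have "(a * b' - b * a') * y$3 = 0" "(a * b' - b * a') * y$4 = 0"
      unfolding 0 by simp_all
    with 0(3,4) assms show ?thesis by (simp add: vec4_eq_iff)
  qed
qed

section \<open>Normal forms within each family\<close>

lemma isomorphic_T_list_trans: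
  assumes "algebra_isomorphic s P t Q" "\<exists>R\<in>T_list. algebra_isomorphic t Q (*s) R"
  shows "\<exists>R\<in>T_list. algebra_isomorphic s P (*s) R"
  using assms algebra_isomorphic_trans by blast

text \<open>The generator \<open>e\<^sub>1 + x e\<^sub>2\<close> changes \<open>a'\<close> into \<open>a' + x D\<close>, so \<open>a'\<close> survives only if \<open>D = 0\<close>, which is
  the equation for \<open>\<alpha>\<close> in \<open>T06\<close>.\<close>

lemma isomorphic_T05_T06:
  assumes "c' = \<alpha> + (1 - \<mu>) / 3"
  shows "\<exists>R\<in>T_list. algebra_isomorphic (*s) (flag_mult0 \<mu> a' 1 0 c' \<alpha> 1 0) (*s) R"
proof -
  define D where "D = 2 * \<alpha> - (2 * \<mu>^2 + 5 * \<mu> - 1) / 3"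
  consider "D \<noteq> 0" | "D = 0" "a' = 0" | "D = 0" "a' \<noteq> 0" by blast
  then show ?thesis
  proof cases
    case 1
    define x where "x = - a' / D"
    have "algebra_isomorphic (*s) (flag_mult0 \<mu> a' 1 0 c' \<alpha> 1 0) (*s) (T05 \<mu> \<alpha>)"
      unfolding T_eq_flag_mult
    \<comment> \<open>The value of \<open>n\<close> is forced by requiring that the new
      \<open>b'\<close> be zero.\<close>
    proof (rule flag_mult0_isomorphic[where k = 1 and x = x and m = 1 and d = 1
          and n = "x * c' + x * (\<mu> + 1)"])
      have a': "a' = - (x * D)" using 1 by (simp add: x_def)
      then show "\<mu> * (x * c' + x * (\<mu> + 1)) + 0 * 1 =
        1^3 * a' + 1^2 * x * (\<mu> + 1) * \<alpha> + 1^2 * x * c' + 1 * x^2 * (\<mu> + 1) * 0"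
        unfolding assms a' D_def by (simp add: field_simps power2_eq_square)
    qed (simp_all add: assms)
    then show ?thesis unfolding T_list_def by blast
  next
    case 2
    have "flag_mult0 \<mu> a' 1 0 c' \<alpha> 1 0 = T05 \<mu> \<alpha>"
      using 2 by (simp add: T_eq_flag_mult assms)
    moreover have "T05 \<mu> \<alpha> \<in> T_list" unfolding T_list_def by blast
    ultimately show ?thesis
      using algebra_isomorphic_refl[OF vec.vector_space_axioms] by metis
  next
    case 3
    have "\<alpha> = (2 * \<mu>^2 + 5 * \<mu> - 1) / 6"
      using 3(1) by (simp add: D_def field_simps)
    \<comment> \<open>A pure rescaling with \<open>m = k^3\<close> and \<open>d = k^4\<close>
      divides \<open>a'\<close> by \<open>k\<close>.\<close>
    then have "algebra_isomorphic (*s) (flag_mult0 \<mu> a' 1 0 c' \<alpha> 1 0) (*s) (T06 \<mu>)"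
      unfolding T_eq_flag_mult using 3(2)
      by (intro flag_mult0_isomorphic[where k = a' and x = 0 and m = "a'^3" and d = "a'^4" and n = 0])
        (simp_all add: assms power_numeral_reduce)
    then show ?thesis unfolding T_list_def by blast
  qed
qed

text \<open>The new generator changes \<open>a'\<close> into \<open>a' + 2 * x\<close>, so it can
  always be removed.\<close>

lemma isomorphic_T07:
  "\<exists>R\<in>T_list. algebra_isomorphic (*s) (flag_mult0 \<mu> a' 1 0 1 1 0 0) (*s) R"
proof -
  have "algebra_isomorphic (*s) (flag_mult0 \<mu> a' 1 0 1 1 0 0) (*s) (T07 \<mu>)"
    unfolding T_eq_flag_mult
    by (rule flag_mult0_isomorphic[where k = 1 and x = "- a' / 2" and m = 1 and d = 1 and n = "- a' / 2"])
      (simp_all add: field_simps)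
  then show ?thesis unfolding T_list_def by blast
qed

text \<open>The new generator changes \<open>b'\<close> into \<open>b' - 2 * x\<close>, and
  \<open>n\<close> restores \<open>a' = 0\<close>.\<close>

lemma isomorphic_T02:
  "\<exists>R\<in>T_list. algebra_isomorphic (*s) (flag_mult0 1 0 0 b' 1 \<alpha> (-3) 0) (*s) R"
proof -
  have "algebra_isomorphic (*s) (flag_mult0 1 0 0 b' 1 \<alpha> (-3) 0) (*s) (T02 \<alpha>)"
    unfolding T_eq_flag_mult
    by (rule flag_mult0_isomorphic[where k = 1 and x = "b' / 2" and m = 1 and d = 1
          and n = "b' / 2 * (\<alpha> + 1)"]) (simp_all add: field_simps)
  then show ?thesis unfolding T_list_def by blast
qed

text \<open>With \<open>c' = q = 0\<close> the choice of \<open>x\<close> does not affect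
  \<open>b'\<close>, so only rescaling by \<open>k\<close> remains; it divides \<open>b'\<close> by
  \<open>k\<close>.\<close>

lemma isomorphic_T03_T04:
  "\<exists>R\<in>T_list. algebra_isomorphic (*s) (flag_mult0 1 0 0 b' 0 1 0 0) (*s) R"
proof (cases "b' = 0")
  case True
  moreover have "T03 \<in> T_list" unfolding T_list_def by blast
  ultimately show ?thesis
    using algebra_isomorphic_refl[OF vec.vector_space_axioms] T_eq_flag_mult(3) by metis
next
  case False
  then have "algebra_isomorphic (*s) (flag_mult0 1 0 0 b' 0 1 0 0) (*s) T04"
    unfolding T_eq_flag_mult
    by (intro flag_mult0_isomorphic[where k = b' and x = 0 and m = "b'^3" and d = "b'^4" and n = 0])
      (simp_all add: power_numeral_reduce)
  then show ?thesis unfolding T_list_def by blast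
qed

text \<open>Keeping \<open>p = 0\<close> while \<open>r = 1\<close> forces \<open>x = 0\<close>.
  Rescaling with \<open>m = k^3\<close> and \<open>d = k^5\<close> divides \<open>q\<close> by
  \<open>k\<close> and \<open>a'\<close> by \<open>k^2\<close>, which explains the choices
  \<open>k = q\<close> and the square root of \<open>a'\<close>.\<close>

lemma isomorphic_T08_T09_T10:
  "\<exists>R\<in>T_list. algebra_isomorphic (*s) (flag_mult0 0 a' 1 0 (q / 3) 0 q 1) (*s) R"
proof -
  consider "q \<noteq> 0" | "q = 0" "a' = 0" | "q = 0" "a' \<noteq> 0" by blast
  then show ?thesis
  proof cases
    case 1
    then have "algebra_isomorphic (*s) (flag_mult0 0 a' 1 0 (q / 3) 0 q 1) (*s) (T10 (a' / q^2))"
      unfolding T_eq_flag_mult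
      by (intro flag_mult0_isomorphic[where k = q and x = 0 and m = "q^3" and d = "q^5" and n = 0])
        (simp_all add: power_numeral_reduce)
    then show ?thesis unfolding T_list_def by blast
  next
    case 2
    moreover have "T08 \<in> T_list" unfolding T_list_def by blast
    ultimately show ?thesis
      using algebra_isomorphic_refl[OF vec.vector_space_axioms] T_eq_flag_mult(8) by (metis div_0)
  next
    case 3
    define k where "k = csqrt a'"
    have k: "a' = k^2" "k \<noteq> 0" using 3 by (simp_all add: k_def)
    have "algebra_isomorphic (*s) (flag_mult0 0 a' 1 0 (q / 3) 0 q 1) (*s) T09"
      unfolding T_eq_flag_mult using 3 k
      by (intro flag_mult0_isomorphic[where k = k and x = 0 and m = "k^3" and d = "k^5" and n = 0])
        (simp_all add: power_numeral_reduce)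
    then show ?thesis unfolding T_list_def by blast
  qed
qed

lemma flag_mult0_isomorphic_T_list:
  assumes ab: "a \<noteq> 0 \<or> b \<noteq> 0" and ar: "a * r = 0" and c': "c' = b * p + (b - a) * q / 3"
    and gen: "c' = 0 \<Longrightarrow> p = 0 \<Longrightarrow> q = 0 \<Longrightarrow> r = 0 \<Longrightarrow> a * b' \<noteq> b * a'"
  shows "\<exists>R\<in>T_list. algebra_isomorphic (*s) (flag_mult0 a a' b b' c' p q r) (*s) R"
proof -
  consider (r) "r \<noteq> 0" "a = 0" "b \<noteq> 0" | (pq) "r = 0" "p = 0" "q = 0"
    | (bq) "r = 0" "b \<noteq> 0" "q \<noteq> 0" | (bp) "r = 0" "b \<noteq> 0" "q = 0" "p \<noteq> 0"
    | (aq) "r = 0" "b = 0" "a \<noteq> 0" "q \<noteq> 0" | (ap) "r = 0" "b = 0" "a \<noteq> 0" "q = 0" "p \<noteq> 0"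
    using ab ar by auto
  then show ?thesis
  proof cases
    case r
    \<comment> \<open>Chosen to remove \<open>p\<close>, which becomes a multiple of
      \<open>p + x * r\<close>.\<close>
    define x where "x = - p / r"
    have "algebra_isomorphic (*s) (flag_mult0 a a' b b' c' p q r)
        (*s) (flag_mult0 0 ((a' + x * b * p + x * c' + x^2 * b * r) / (b * r)) 1 0 (q / r / 3) 0 (q / r) 1)"
      using r by (intro flag_mult0_isomorphic[where k = 1 and x = x and m = b and d = "b * r"
            and n = "b' + x * c' + x * b * q"]) (simp_all add: c' x_def field_simps)
    then show ?thesis using isomorphic_T08_T09_T10 by (rule isomorphic_T_list_trans)
  next
    case pq
    then have "c' = 0" by (simp add: c')
    with pq gen flag_mult0_isomorphic_T01[of a b' b a'] show ?thesis
      unfolding T_list_def by blast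
  next
    case bq
    \<comment> \<open>The new third vector is the product of \<open>e 2\<close> and
      \<open>e 1\<close>, which removes \<open>b'\<close>; \<open>d\<close> is chosen so that the
      new \<open>q\<close> is 1.\<close>
    have "algebra_isomorphic (*s) (flag_mult0 a a' b b' c' p q r)
        (*s) (flag_mult0 (a / b) ((a' - a / b * b') / (b * q)) 1 0 (c' / (b * q)) (p / q) 1 0)"
      using bq by (intro flag_mult0_isomorphic[where k = 1 and x = 0 and m = b and d = "b * q"
            and n = b']) (simp_all add: field_simps)
    moreover have "c' / (b * q) = p / q + (1 - a / b) / 3"
      using bq by (simp add: c' field_simps)
    ultimately show ?thesis using isomorphic_T05_T06 by (blast intro: isomorphic_T_list_trans)
  next
    case bp
    have "algebra_isomorphic (*s) (flag_mult0 a a' b b' c' p q r)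
        (*s) (flag_mult0 (a / b) ((a' - a / b * b') / (b * p)) 1 0 1 1 0 0)"
      using bp by (intro flag_mult0_isomorphic[where k = 1 and x = 0 and m = b and d = "b * p"
            and n = b']) (simp_all add: c' field_simps)
    then show ?thesis using isomorphic_T07 by (rule isomorphic_T_list_trans)
  next
    case aq
    \<comment> \<open>Now the third vector is the product of \<open>e 1\<close> and
      \<open>e 2\<close>, and the fourth is the square of \<open>e 2\<close>, because
      \<open>c' = - a * q / 3\<close> when \<open>b = 0\<close>. This produces the constant
      -3.\<close>
    have "algebra_isomorphic (*s) (flag_mult0 a a' b b' c' p q r)
        (*s) (flag_mult0 1 0 0 (b' / (- a * q / 3)) 1 (- 3 * p / q) (-3) 0)"
      using aq by (intro flag_mult0_isomorphic[where k = 1 and x = 0 and m = a and d = "- a * q / 3"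
            and n = a']) (simp_all add: c' field_simps)
    then show ?thesis using isomorphic_T02 by (rule isomorphic_T_list_trans)
  next
    case ap
    have "algebra_isomorphic (*s) (flag_mult0 a a' b b' c' p q r)
        (*s) (flag_mult0 1 0 0 (b' / (a * p)) 0 1 0 0)"
      using ap by (intro flag_mult0_isomorphic[where k = 1 and x = 0 and m = a and d = "a * p"
            and n = a']) (simp_all add: c' field_simps)
    then show ?thesis using isomorphic_T03_T04 by (rule isomorphic_T_list_trans)
  qed
qed

theorem theoremA:
  fixes sc :: "complex \<Rightarrow> 'v::ab_group_add \<Rightarrow> 'v"
    and P :: "'v \<Rightarrow> 'v \<Rightarrow> 'v"
  shows "infinite (algs4 // iso_rel4) \<and>
         (\<forall>Q\<in>T_list. one_gen_nilp_term_alg4 (*s) Q) \<and>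
         (one_gen_nilp_term_alg4 sc P \<longrightarrow>
           (\<exists>Q\<in>T_list. algebra_isomorphic sc P (*s) Q))"
proof (intro conjI ballI impI)
  show "infinite (algs4 // iso_rel4)" by (rule infinite_iso_classes)
  show "one_gen_nilp_term_alg4 (*s) Q" if "Q \<in> T_list" for Q
    using that by (rule T_list_in_class)
  assume "one_gen_nilp_term_alg4 sc P"
  then have P: "complex_algebra sc P" "vector_space.dim sc (UNIV :: 'v set) = 4"
    "complex_algebra.one_generated sc P" "complex_algebra.nilpotent sc P"
    and terminal: "complex_algebra.terminal P"
    unfolding one_gen_nilp_term_alg4_def by auto
  obtain a a' b b' c c' p q r s t where
    iso: "algebra_isomorphic (*s) (flag_mult a a' b b' c c' p q r s t) sc P" and
    gen: "\<And>S. complex_algebra.subalgebra (*s) (flag_mult a a' b b' c c' p q r s t) S \<Longrightarrow> e 1 \<in> S \<Longrightarrow> S = UNIV"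
    using ex_isomorphic_flag_mult[OF P] by blast
  note terminal = terminal_isomorphic[OF iso complex_algebra_flag_mult P(1) terminal]
  have "a \<noteq> 0 \<or> b \<noteq> 0 \<or> c \<noteq> 0"
    by (rule flag_mult_generated_imp(1)[of a a' b b' c c' p q r s t]) (rule gen)
  note eqs = terminal_flag_mult_imp[OF terminal this]
  have "a * b' \<noteq> b * a'" if "c' = 0" "p = 0" "q = 0" "r = 0"
    by (rule flag_mult_generated_imp(2)[of a a' b b' c c' p q r s t, OF gen]) (simp_all add: that eqs(1-3))
  have "\<exists>R\<in>T_list. algebra_isomorphic (*s) (flag_mult0 a a' b b' c' p q r) (*s) R"
    by (rule flag_mult0_isomorphic_T_list[OF eqs(5,4,6)]) fact
  then show "\<exists>Q\<in>T_list. algebra_isomorphic sc P (*s) Q"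
    by (rule isomorphic_T_list_trans[OF algebra_isomorphic_sym[OF iso[unfolded eqs(1-3)]]])
qed

end
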